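(* Let $k\geq 2$. There is no $k$-geodetic digraph with minimum out-degree at least $2$ and order $M(2,k)+2$ (where $M(2,k)=1+2+\dots+2^k$) whose in-degree sequence is $(1,1,1,1,2,\dots,2,3,3,4)$, i.e. exactly four vertices have in-degree $1$, exactly two have in-degree $3$, exactly one has in-degree $4$, and all others have in-degree $2$.
   Context: A digraph is $k$-geodetic if for any two vertices $u,v$ there is at most one directed walk from $u$ to $v$ of length at most $k$. The in-degree sequence is the list of in-degrees of the vertices in non-decreasing order. *)

theory Defs
  imports "Graph_Theory.Graph_Theory" "HOL-Library.Multiset"
begin

(* Walks are arc lists, so two walks that differ only in the choice of parallel arcs count as
   different, and the empty walk from u to u counts as a walk of length 0.  Hence a k-geodetic
   digraph with 1 <= k has neither parallel arcs nor loops, and no directed cycle of length at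
   most k. *)
definition k_geodetic :: "('a, 'b) pre_digraph \<Rightarrow> nat \<Rightarrow> bool" where
  "k_geodetic G k \<longleftrightarrow>
     (\<forall>u\<in>verts G. \<forall>v\<in>verts G. \<forall>p q.
        pre_digraph.awalk G u p v \<and> length p \<le> k \<and>
        pre_digraph.awalk G u q v \<and> length q \<le> k \<longrightarrow> p = q)"

(* Only meaningful if the vertex set is finite and nonempty. *)
definition min_out_degree :: "('a, 'b) pre_digraph \<Rightarrow> nat" where
  "min_out_degree G = Min (out_degree G ` verts G)"

definition in_degree_sequence :: "('a, 'b) pre_digraph \<Rightarrow> nat list" where
  "in_degree_sequence G = sorted_list_of_multiset (image_mset (in_degree G) (mset_set (verts G)))"

definition moore_bound :: "nat \<Rightarrow> nat \<Rightarrow> nat" where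
  "moore_bound d k = (\<Sum>i=0..k. d ^ i)"

end

theory Submission
  imports Defs
begin

text \<open>Counting arcs shows that all out-degrees are 2, so each vertex \<open>u\<close> has exactly two outliers,
  i.e. vertices that it does not reach by a walk of length at most \<open>k\<close>. A child of \<open>u\<close> reaches at
  most one in-neighbour of a given vertex within \<open>k - 1\<close> steps, so all outliers lie in the
  in-neighbourhood of the vertex \<open>v\<close> of in-degree 4, and each in-neighbourhood of size 3 contains an
  outlier of every vertex. A vertex of in-degree 1 is an outlier of one of any two siblings. Hence
  the set \<open>S\<close> of vertices of in-degree 1 equals the in-neighbourhood of \<open>v\<close>, siblings have
  complementary outlier pairs in \<open>S\<close>, and the vertices \<open>z, z'\<close> of in-degree 3 have two in-neighbours
  in \<open>S\<close> each. Then neither \<open>v\<close> nor \<open>z'\<close> can reach \<open>z\<close> in fewer than \<open>k\<close> steps, so the in-tree of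
  \<open>z\<close> of depth \<open>k\<close> has at most \<open>1 + 3 + 4 + 8 + \<dots> + 2 ^ k = 2 ^ (k + 1)\<close> vertices. But \<open>z\<close> is nobody's
  outlier, so this in-tree contains all \<open>2 ^ (k + 1) + 1\<close> vertices.\<close>

text \<open>The three uniqueness axioms are those consequences of the uniqueness of short walks that can
  be stated without naming the walks.\<close>
locale geodetic_relation =
  fixes V :: "'a set" and E :: "'a rel" and k :: nat
  assumes finite_V: "finite V"
    and E_subset: "E \<subseteq> V \<times> V"
    and length_unique: "(u, w) \<in> E ^^ i \<Longrightarrow> (u, w) \<in> E ^^ j \<Longrightarrow> u \<in> V \<Longrightarrow> i \<le> k \<Longrightarrow> j \<le> k \<Longrightarrow> i = j"
    and last_unique: "(u, x) \<in> E ^^ i \<Longrightarrow> (x, w) \<in> E \<Longrightarrow> (u, y) \<in> E ^^ j \<Longrightarrow> (y, w) \<in> E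
      \<Longrightarrow> i < k \<Longrightarrow> j < k \<Longrightarrow> x = y"
    and first_unique: "(u, x) \<in> E \<Longrightarrow> (x, w) \<in> E ^^ i \<Longrightarrow> (u, y) \<in> E \<Longrightarrow> (y, w) \<in> E ^^ j
      \<Longrightarrow> i < k \<Longrightarrow> j < k \<Longrightarrow> x = y"
    and out_two: "u \<in> V \<Longrightarrow> card (E `` {u}) = 2"
begin

section \<open>Reachability and in-neighbourhoods\<close>

definition reach :: "nat \<Rightarrow> 'a \<Rightarrow> 'a set" where
  "reach j u = {w. \<exists>i\<le>j. (u, w) \<in> E ^^ i}"

definition ins :: "'a \<Rightarrow> 'a set" where
  "ins w = {x. (x, w) \<in> E}"

definition outliers :: "'a \<Rightarrow> 'a set" where
  "outliers u = V - reach k u"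

lemma relpow_in_V: "(u, w) \<in> E ^^ j \<Longrightarrow> u \<in> V \<Longrightarrow> w \<in> V"
  using E_subset by (induction j arbitrary: w) auto

lemma relpow_in_V': "(u, w) \<in> E ^^ j \<Longrightarrow> w \<in> V \<Longrightarrow> u \<in> V"
  using E_subset by (cases j) (auto elim: relpow_Suc_E2 simp del: relpow.simps(2))

lemma reach_pred_iff: "0 < k \<Longrightarrow> w \<in> reach (k - 1) u \<longleftrightarrow> (\<exists>i<k. (u, w) \<in> E ^^ i)"
  unfolding reach_def by (cases k) (auto simp: less_Suc_eq_le)

lemma reach_subset: "u \<in> V \<Longrightarrow> reach j u \<subseteq> V"
  using relpow_in_V unfolding reach_def by blast

lemma ins_subset: "ins w \<subseteq> V"
  using E_subset unfolding ins_def by blast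

lemma finite_ins: "finite (ins w)"
  using ins_subset finite_V finite_subset by blast

text \<open>The arc closes the walk to one of length \<open>Suc i\<close>, at most \<open>k\<close>,
  which competes with the empty walk at \<open>u\<close>.\<close>

lemma no_short_cycle: "(u, x) \<in> E ^^ i \<Longrightarrow> (x, u) \<in> E \<Longrightarrow> i < k \<Longrightarrow> False"
  using length_unique[of u u "Suc i" 0] E_subset by (auto intro: relpow_Suc_I)

lemma children:
  assumes "u \<in> V"
  obtains a b where "E `` {u} = {a, b}" "a \<noteq> b" "(u, a) \<in> E" "(u, b) \<in> E" "a \<in> V" "b \<in> V"
proof -
  obtain a b where ab: "E `` {u} = {a, b}" "a \<noteq> b"
    using out_two[OF assms] by (auto simp: card_2_iff)
  then have "(u, a) \<in> E" "(u, b) \<in> E" by auto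
  with ab that E_subset show ?thesis by blast
qed

lemma reach_children:
  assumes "E `` {u} = {a, b}" "w \<in> reach k u"
  shows "w = u \<or> w \<in> reach (k - 1) a \<or> w \<in> reach (k - 1) b"
proof -
  obtain i where i: "i \<le> k" "(u, w) \<in> E ^^ i" using assms(2) unfolding reach_def by blast
  show ?thesis
  proof (cases i)
    case 0 then show ?thesis using i by simp
  next
    case (Suc m)
    then obtain c where c: "(u, c) \<in> E" "(c, w) \<in> E ^^ m" using i by (meson relpow_Suc_E2)
    then have "c \<in> {a, b}" using assms(1) by blast
    then show ?thesis using c Suc i unfolding reach_def by fastforce
  qed
qed

section \<open>Counting the vertices reached\<close>

text \<open>By \<open>last_unique\<close> distinct vertices of one layer have disjoint sets of
  children, so every layer doubles the previous one.\<close>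

lemma card_layer:
  assumes "u \<in> V" "j \<le> k"
  shows "card {w. (u, w) \<in> E ^^ j} = 2 ^ j"
  using assms(2)
proof (induction j)
  case 0
  have "{w. u = w} = {u}" by auto
  then show ?case by simp
next
  case (Suc j)
  have eq: "{w. (u, w) \<in> E ^^ Suc j} = (\<Union>x\<in>{w. (u, w) \<in> E ^^ j}. E `` {x})"
    by auto
  have fin: "finite {w. (u, w) \<in> E ^^ j}"
    by (rule finite_subset[OF _ finite_V]) (use assms(1) relpow_in_V in blast)
  have "card (\<Union>x\<in>{w. (u, w) \<in> E ^^ j}. E `` {x}) = (\<Sum>x\<in>{w. (u, w) \<in> E ^^ j}. card (E `` {x}))"
  proof (rule card_UN_disjoint[OF fin])
    show "\<forall>x\<in>{w. (u, w) \<in> E ^^ j}. finite (E `` {x})"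
      by (meson E_subset Image_subset finite_V finite_subset)
    show "\<forall>x\<in>{w. (u, w) \<in> E ^^ j}. \<forall>y\<in>{w. (u, w) \<in> E ^^ j}. x \<noteq> y \<longrightarrow> E `` {x} \<inter> E `` {y} = {}"
      using last_unique[of u _ j _ _ j] Suc.prems by fastforce
  qed
  also have "\<dots> = (\<Sum>x\<in>{w. (u, w) \<in> E ^^ j}. 2)"
    by (rule sum.cong) (use out_two relpow_in_V assms(1) in auto)
  also have "\<dots> = 2 ^ Suc j" using Suc by simp
  finally show ?case using eq by simp
qed

lemma card_reach:
  assumes "u \<in> V"
  shows "card (reach k u) = 2 ^ (k + 1) - 1"
proof -
  have eq: "reach k u = (\<Union>j\<in>{..k}. {w. (u, w) \<in> E ^^ j})" unfolding reach_def by blast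
  have "card (reach k u) = (\<Sum>j\<in>{..k}. card {w. (u, w) \<in> E ^^ j})"
    unfolding eq
  proof (rule card_UN_disjoint)
    show "\<forall>j\<in>{..k}. finite {w. (u, w) \<in> E ^^ j}"
      using assms relpow_in_V finite_subset[OF _ finite_V] by (metis mem_Collect_eq subsetI)
    show "\<forall>i\<in>{..k}. \<forall>j\<in>{..k}. i \<noteq> j \<longrightarrow> {w. (u, w) \<in> E ^^ i} \<inter> {w. (u, w) \<in> E ^^ j} = {}"
      using length_unique assms by blast
  qed simp
  also have "\<dots> = (\<Sum>j<Suc k. 2 ^ j)"
    using card_layer[OF assms] by (simp add: lessThan_Suc_atMost)
  also have "\<dots> = 2 ^ (k + 1) - 1"
    using mask_eq_sum_exp_nat[of "Suc k"] by (simp add: lessThan_def)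
  finally show ?thesis .
qed

section \<open>In-neighbours, reached vertices and outliers\<close>

text \<open>Two such in-neighbours would be the penultimate vertices of two walks of length at most
  \<open>k\<close> from \<open>a\<close> to \<open>w\<close>.\<close>

lemma card_ins_reach_le_1:
  "card (ins w \<inter> reach (k - 1) a) \<le> 1" if "0 < k"
proof -
  have "x = y" if "x \<in> ins w \<inter> reach (k - 1) a" "y \<in> ins w \<inter> reach (k - 1) a" for x y
    using that last_unique[of a x _ w y] reach_pred_iff[OF \<open>0 < k\<close>] unfolding ins_def by blast
  then show ?thesis using card_le_Suc0_iff_eq[of "ins w \<inter> reach (k - 1) a"] finite_ins by auto
qed

lemma ins_reach_self:
  "0 < k \<Longrightarrow> ins w \<inter> reach (k - 1) w = {}"
  using no_short_cycle reach_pred_iff unfolding ins_def by blast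

text \<open>Each child of \<open>u\<close> contributes at most one in-neighbour. If \<open>u\<close>
  is itself an in-neighbour of \<open>w\<close>, then \<open>w\<close> is one of the children and
  contributes none, which makes room for \<open>u\<close>.\<close>

lemma card_ins_reach_le_2:
  assumes "u \<in> V" "0 < k"
  shows "card (ins w \<inter> reach k u) \<le> 2"
proof -
  obtain a b where ab: "E `` {u} = {a, b}" using children[OF assms(1)] by metis
  let ?A = "ins w \<inter> reach (k - 1) a" and ?B = "ins w \<inter> reach (k - 1) b"
  have le: "card ?A \<le> 1" "card ?B \<le> 1" using card_ins_reach_le_1 assms(2) by auto
  have fin: "finite ?A" "finite ?B" using finite_ins by auto
  show ?thesis
  proof (cases "u \<in> ins w")
    case False
    then have "ins w \<inter> reach k u \<subseteq> ?A \<union> ?B" using reach_children[OF ab] by blast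
    then have "card (ins w \<inter> reach k u) \<le> card (?A \<union> ?B)" by (intro card_mono) (use fin in auto)
    then show ?thesis using card_Un_le[of ?A ?B] le by linarith
  next
    case True
    then have "w \<in> {a, b}" using ab unfolding ins_def by blast
    then have "?A = {} \<or> ?B = {}" using ins_reach_self assms(2) by blast
    then have "card (?A \<union> ?B) \<le> 1" using le by auto
    moreover have "card (ins w \<inter> reach k u) \<le> card (insert u (?A \<union> ?B))"
      by (intro card_mono) (use fin reach_children[OF ab] in auto)
    ultimately show ?thesis using card_insert_le_m1[of 2 "?A \<union> ?B" u] by linarith
  qed
qed

text \<open>This forces outliers: two of them into an in-neighbourhood of size 4, one into an
  in-neighbourhood of size 3.\<close>

lemma card_ins_outliers:
  assumes "u \<in> V" "0 < k"
  shows "card (ins w) \<le> card (ins w \<inter> outliers u) + 2"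
proof -
  have "ins w = (ins w \<inter> outliers u) \<union> (ins w \<inter> reach k u)"
    using ins_subset unfolding outliers_def by blast
  then have "card (ins w) \<le> card (ins w \<inter> outliers u) + card (ins w \<inter> reach k u)"
    using card_Un_le by metis
  then show ?thesis using card_ins_reach_le_2[OF assms, of w] by linarith
qed

text \<open>If both children of \<open>u\<close> reached \<open>w\<close>, then \<open>u\<close> would have two short walks to the
  only in-neighbour of \<open>w\<close>.\<close>
lemma in_degree_1_outlier:
  assumes "w \<in> V" "card (ins w) = 1" "u \<in> V" "E `` {u} = {a, b}" "a \<noteq> b"
  shows "w \<in> outliers a \<union> outliers b"
proof (rule ccontr)
  assume "w \<notin> outliers a \<union> outliers b"
  then have reach: "w \<in> reach k a" "w \<in> reach k b" using assms(1) unfolding outliers_def by auto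
  obtain y where y: "ins w = {y}" using assms(2) by (rule card_1_singletonE)
  have pred: "\<exists>i<k. (c, y) \<in> E ^^ i" if c: "w \<in> reach k c" "w \<noteq> c" for c
  proof -
    obtain i where i: "i \<le> k" "(c, w) \<in> E ^^ i"
      using c(1) by (auto simp: reach_def)
    have "i \<noteq> 0" using i(2) c(2) by (metis relpow_0_E)
    then obtain m where m: "i = Suc m" by (metis not0_implies_Suc)
    then obtain x where x: "(c, x) \<in> E ^^ m" "(x, w) \<in> E" using i(2) by (meson relpow_Suc_E)
    then have "x = y" using y unfolding ins_def by blast
    then show ?thesis using x m i(1) by (intro exI[of _ m]) simp
  qed
  have edge: "(u, a) \<in> E" "(u, b) \<in> E" using assms(4) by auto
  \<comment> \<open>The case that \<open>w\<close> is itself a child: then \<open>y\<close> is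
    \<open>u\<close>, and the other child reaches \<open>w\<close> only by returning to
    \<open>u\<close>, which closes a short cycle.\<close>
  have cyc: False if cd: "w = c" "(u, c) \<in> E" "(u, d) \<in> E" "c \<noteq> d" "w \<in> reach k d" for c d
  proof -
    have "u = y" using cd(1,2) y unfolding ins_def by blast
    moreover obtain i where i: "i < k" "(d, y) \<in> E ^^ i" using pred cd(1,4,5) by blast
    ultimately have "(u, u) \<in> E ^^ Suc i" using relpow_Suc_I2[OF cd(3) i(2)] by simp
    then show False using length_unique[of u u "Suc i" 0] i(1) assms(3) by simp
  qed
  have "w \<noteq> a" "w \<noteq> b"
    using cyc[OF _ edge _ reach(2)] cyc[OF _ edge(2,1) _ reach(1)] assms(5) by auto
  then obtain i j where "i < k" "(a, y) \<in> E ^^ i" "j < k" "(b, y) \<in> E ^^ j"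
    using pred[OF reach(1)] pred[OF reach(2)] by blast
  then show False using first_unique[of u a y i b j] edge assms(5) by blast
qed

section \<open>Bounding the in-tree\<close>

lemma card_in_layer_le:
  assumes "\<And>w. (w, z) \<in> E ^^ j \<Longrightarrow> card (ins w) \<le> 2" "z \<in> V"
  shows "card {w. (w, z) \<in> E ^^ Suc j} \<le> 2 * card {w. (w, z) \<in> E ^^ j}"
proof -
  have eq: "{w. (w, z) \<in> E ^^ Suc j} = (\<Union>x\<in>{w. (w, z) \<in> E ^^ j}. ins x)"
    unfolding ins_def by (auto intro: relpow_Suc_I2 elim: relpow_Suc_E2 simp del: relpow.simps)
  have fin: "finite {w. (w, z) \<in> E ^^ j}"
    by (rule finite_subset[OF _ finite_V]) (use assms(2) relpow_in_V' in blast)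
  have "card {w. (w, z) \<in> E ^^ Suc j} \<le> (\<Sum>x\<in>{w. (w, z) \<in> E ^^ j}. card (ins x))"
    unfolding eq by (rule card_UN_le[OF fin])
  also have "\<dots> \<le> (\<Sum>x\<in>{w. (w, z) \<in> E ^^ j}. 2)"
    by (rule sum_mono) (use assms(1) in blast)
  finally show ?thesis by simp
qed

text \<open>With at least two in-neighbours of in-degree 1 and the third of in-degree at most 2,
  layer 2 has at most 1 + 1 + 2 = 4 vertices. After that \<open>small\<close> lets each layer at
  most double.\<close>

lemma card_coreach_le:
  assumes z: "z \<in> V" and k: "2 \<le> k"
    and small: "\<And>w j. (w, z) \<in> E ^^ j \<Longrightarrow> 0 < j \<Longrightarrow> j < k \<Longrightarrow> card (ins w) \<le> 2"
    and three: "card (ins z) = 3"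
    and ones: "2 \<le> card {x \<in> ins z. card (ins x) = 1}"
  shows "card (\<Union>j\<in>{..k}. {w. (w, z) \<in> E ^^ j}) \<le> 2 ^ (k + 1)"
proof -
  define L where "L j = {w. (w, z) \<in> E ^^ j}" for j
  have L1: "L 1 = ins z" unfolding L_def ins_def by auto
  have L2: "card (L 2) \<le> 4"
  proof -
    let ?P = "{x \<in> ins z. card (ins x) = 1}"
    have "L 2 = (\<Union>x\<in>ins z. ins x)" unfolding L_def ins_def by (auto simp: numeral_2_eq_2)
    then have "card (L 2) \<le> (\<Sum>x\<in>ins z. card (ins x))" using card_UN_le[OF finite_ins] by metis
    also have "\<dots> = (\<Sum>x\<in>?P. card (ins x)) + (\<Sum>x\<in>ins z - ?P. card (ins x))"
      by (subst sum.subset_diff[OF _ finite_ins, of ?P]) auto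
    also have "\<dots> \<le> card ?P + 2 * card (ins z - ?P)"
    proof -
      have "(\<Sum>x\<in>ins z - ?P. card (ins x)) \<le> (\<Sum>x\<in>ins z - ?P. 2)"
        by (rule sum_mono) (use small[of _ 1] k in \<open>auto simp: ins_def\<close>)
      then show ?thesis by simp
    qed
    also have "card (ins z - ?P) = 3 - card ?P"
      using card_Diff_subset[of ?P "ins z"] finite_ins three by simp
    also have "card ?P + 2 * (3 - card ?P) \<le> 4"
      using ones card_mono[OF finite_ins, of ?P z] three by auto
    finally show ?thesis .
  qed
  \<comment> \<open>The index starts at 2 because layer 1 has three vertices, one more than the
    bound \<open>2 ^ j\<close> would allow.\<close>
  have L: "card (L (Suc (Suc m))) \<le> 2 ^ Suc (Suc m)" if "Suc (Suc m) \<le> k" for m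
    using that
  proof (induction m)
    case 0
    then show ?case using L2 by (simp add: numeral_2_eq_2)
  next
    case (Suc m)
    have "card (L (Suc (Suc (Suc m)))) \<le> 2 * card (L (Suc (Suc m)))"
      unfolding L_def
    proof (rule card_in_layer_le[OF _ z])
      show "card (ins w) \<le> 2" if "(w, z) \<in> E ^^ Suc (Suc m)" for w
        using small[OF that] Suc.prems by simp
    qed
    then show ?case using Suc by simp
  qed
  \<comment> \<open>Layers 0 and 1 give 1 + 3 = 4, and layer \<open>j\<close> then adds at most
    \<open>2 ^ j\<close> to a total of at most \<open>2 ^ j\<close>.\<close>
  have total: "(\<Sum>j\<le>Suc m. card (L j)) \<le> 2 ^ (Suc m + 1)" if "Suc m \<le> k" for m
    using that
  proof (induction m)
    case 0
    have "L 0 = {z}" unfolding L_def by auto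
    then show ?case using L1 three by simp
  next
    case (Suc m)
    then show ?case using L[of m] by simp
  qed
  have "card (\<Union>j\<in>{..k}. L j) \<le> (\<Sum>j\<le>k. card (L j))" by (rule card_UN_le) simp
  also have "\<dots> \<le> 2 ^ (k + 1)" using total[of "k - 1"] k by simp
  finally show ?thesis unfolding L_def .
qed

section \<open>The contradiction for the relation\<close>

text \<open>\<open>card_reach\<close> leaves exactly two vertices unreached, and
  \<open>card_ins_outliers\<close> already places two outliers among the four in-neighbours of
  \<open>v\<close>.\<close>

lemma outliers_subset_ins:
  assumes "card V = 2 ^ (k + 1) + 1" "card (ins v) = 4" "u \<in> V" "0 < k"
  shows "outliers u \<subseteq> ins v" "card (outliers u) = 2"
proof -
  have "card (outliers u) = card V - card (reach k u)"
    unfolding outliers_def using reach_subset[OF assms(3)] finite_V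
    by (meson card_Diff_subset finite_subset)
  then show two: "card (outliers u) = 2"
    using card_reach[OF assms(3)] assms(1) by simp
  have "card (ins v \<inter> outliers u) \<ge> 2"
    using card_ins_outliers[OF assms(3,4), of v] assms(2) by linarith
  moreover have "finite (outliers u)" unfolding outliers_def using finite_V by simp
  ultimately have "ins v \<inter> outliers u = outliers u" using two by (intro card_seteq) auto
  then show "outliers u \<subseteq> ins v" by blast
qed

theorem no_in_degrees_1111334:
  assumes k: "2 \<le> k" and order: "card V = 2 ^ (k + 1) + 1"
    and ones: "card {x \<in> V. card (ins x) = 1} = 4"
    and v: "v \<in> V" "card (ins v) = 4"
    and z: "z \<in> V" "card (ins z) = 3"
    and z': "z' \<in> V" "card (ins z') = 3" "z' \<noteq> z"
    and others: "\<And>x. x \<in> V \<Longrightarrow> x \<notin> {v, z, z'} \<Longrightarrow> card (ins x) \<le> 2"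
  shows False
proof -
  define S where "S = ins v"
  have k0: "0 < k" using k by simp
  note out = outliers_subset_ins[OF order v(2) _ k0, folded S_def]
  have finS: "finite S" "card S = 4" unfolding S_def using finite_ins v by auto
  obtain a b where ab: "E `` {v} = {a, b}" "a \<noteq> b" "a \<in> V" "b \<in> V" using children[OF v(1)] by metis
  have "{x \<in> V. card (ins x) = 1} \<subseteq> S"
    using in_degree_1_outlier[OF _ _ v(1) ab(1,2)] out(1) ab by blast
  then have S: "{x \<in> V. card (ins x) = 1} = S"
    using ones finS by (intro card_subset_eq) auto
  \<comment> \<open>The four elements of \<open>S\<close> are covered by two pairs of outliers, so
    these pairs must be disjoint.\<close>
  have "S \<subseteq> outliers a \<union> outliers b"
    using in_degree_1_outlier[OF _ _ v(1) ab(1,2)] S by blast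
  then have "card S \<le> card (outliers a \<union> outliers b)"
    by (intro card_mono) (auto simp: outliers_def finite_V)
  moreover have fin_out: "finite (outliers a)" "finite (outliers b)"
    unfolding outliers_def using finite_V by auto
  ultimately have "card (outliers a \<inter> outliers b) = 0"
    using card_Un_Int[OF fin_out] out(2)[OF ab(3)] out(2)[OF ab(4)] finS by linarith
  then have disj: "outliers a \<inter> outliers b = {}"
    using fin_out by simp
  \<comment> \<open>\<open>y\<close> has an in-neighbour among the outliers of \<open>a\<close> and
    one among those of \<open>b\<close>; by disjointness they differ.\<close>
  have two: "2 \<le> card (ins y \<inter> S)" if y: "card (ins y) = 3" for y
  proof -
    have "card (ins y \<inter> outliers c) \<noteq> 0" if "c \<in> V" for c
      using card_ins_outliers[OF that k0, of y] y by linarith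
    then have "card (ins y \<inter> outliers a) \<ge> 1" "card (ins y \<inter> outliers b) \<ge> 1"
      using ab by (metis less_one not_less)+
    moreover have "card (ins y \<inter> outliers a) + card (ins y \<inter> outliers b)
        = card ((ins y \<inter> outliers a) \<union> (ins y \<inter> outliers b))"
      using disj finite_ins by (intro card_Un_disjoint[symmetric]) auto
    moreover have "\<dots> \<le> card (ins y \<inter> S)"
      by (rule card_mono) (use finite_ins out(1) ab in auto)
    ultimately show ?thesis by linarith
  qed
  have neq: "v \<noteq> z" "v \<noteq> z'" using v z z' by auto
  \<comment> \<open>A common element would have the three out-neighbours \<open>v\<close>,
    \<open>z\<close> and \<open>z'\<close>.\<close>
  have disj_zz': "(ins z \<inter> S) \<inter> (ins z' \<inter> S) = {}"
  proof (rule ccontr)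
    assume "\<not> ?thesis"
    then obtain x where "(x, v) \<in> E" "(x, z) \<in> E" "(x, z') \<in> E" unfolding S_def ins_def by auto
    then have x: "{v, z, z'} \<subseteq> E `` {x}" "card (E `` {x}) = 2" using E_subset out_two by auto
    then have "card {v, z, z'} \<le> 2" by (metis card.infinite card_mono zero_neq_numeral)
    then show False using neq z' by auto
  qed
  have "card (ins z \<inter> S) + card (ins z' \<inter> S) = card ((ins z \<inter> S) \<union> (ins z' \<inter> S))"
    using disj_zz' finite_ins by (intro card_Un_disjoint[symmetric]) auto
  moreover have "card ((ins z \<inter> S) \<union> (ins z' \<inter> S)) \<le> card S"
    by (rule card_mono) (use finS in auto)
  \<comment> \<open>Two disjoint parts of size at least 2 exhaust the four elements of
    \<open>S\<close>. Hence \<open>z'\<close> has a third in-neighbour \<open>t\<close> outside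
    \<open>S\<close>.\<close>
  ultimately have "card (ins z' \<inter> S) = 2" and "card ((ins z \<inter> S) \<union> (ins z' \<inter> S)) = card S"
    using two[OF z(2)] two[OF z'(2)] finS by linarith+
  then have S_split: "(ins z \<inter> S) \<union> (ins z' \<inter> S) = S"
    using finS by (intro card_subset_eq) auto
  have "\<not> ins z' \<subseteq> S" using \<open>card (ins z' \<inter> S) = 2\<close> z'(2) by (auto simp: Int_absorb2)
  then obtain t where t: "(t, z') \<in> E" "t \<notin> S" unfolding ins_def by blast
  have "ins z \<inter> S \<noteq> {}" "ins z' \<inter> S \<noteq> {}" using two[OF z(2)] two[OF z'(2)] by auto
  then obtain p p' where p: "(p, v) \<in> E" "(p, z) \<in> E" and p': "(p', v) \<in> E" "(p', z') \<in> E"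
    unfolding S_def ins_def by blast
  \<comment> \<open>\<open>p\<close> has arcs to both \<open>v\<close> and \<open>z\<close>, so a
    short walk from \<open>v\<close> to \<open>z\<close> would give it a second short walk to
    \<open>z\<close>.\<close>
  have far_v: False if "(v, z) \<in> E ^^ i" "i < k" for i
    using first_unique[of p v z i z 0] p that k0 neq by auto
  \<comment> \<open>Given such a walk, \<open>z'\<close> reaches nothing in \<open>S\<close> within
    \<open>k - 1\<close> steps. So the other child \<open>y\<close> of \<open>t\<close> must reach
    both elements of \<open>S\<close> that are not outliers of \<open>t\<close>, although it can
    reach only one in-neighbour of \<open>v\<close>.\<close>
  have far_z': False if walk: "(z', z) \<in> E ^^ i" "i < k" for i
  proof -
    have empty: "x \<notin> reach (k - 1) z'" if "x \<in> S" for x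
    proof
      assume "x \<in> reach (k - 1) z'"
      then obtain j where j: "j < k" "(z', x) \<in> E ^^ j"
        using reach_pred_iff[OF k0] by blast
      have "x \<in> ins z \<or> x \<in> ins z'" using that S_split by blast
      \<comment> \<open>An arc from \<open>x\<close> to \<open>z'\<close> would close a short cycle.
        Hence the walk through \<open>x\<close> to \<open>z\<close> has the length \<open>i\<close>
        of the given one, so replacing its last arc by the one to \<open>v\<close> yields a walk of
        length below \<open>k\<close> from \<open>z'\<close> to \<open>v\<close>. But
        \<open>p'\<close> has arcs to both \<open>z'\<close> and \<open>v\<close>.\<close>
      then have xz: "(x, z) \<in> E" using no_short_cycle[OF j(2) _ j(1)] unfolding ins_def by blast
      have xv: "(x, v) \<in> E" using that unfolding S_def ins_def by blast
      have "Suc j = i"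
        using length_unique[of z' z "Suc j" i] relpow_Suc_I[OF j(2) xz] walk j z'(1) by simp
      then have "Suc j < k" using walk by simp
      then show False
        using first_unique[of p' z' v "Suc j" v 0] p' relpow_Suc_I[OF j(2) xv] neq k0 by auto
    qed
    have tV: "t \<in> V" using t E_subset by blast
    obtain c d where cd: "E `` {t} = {c, d}" using children[OF tV] by metis
    then obtain y where y: "E `` {t} = {z', y}" using t by (metis ImageI insert_commute insert_iff singletonD singletonI)
    have "S - outliers t \<subseteq> S \<inter> reach (k - 1) y"
    proof
      fix x assume x: "x \<in> S - outliers t"
      then have "x \<in> reach k t" using ins_subset unfolding S_def outliers_def by blast
      then show "x \<in> S \<inter> reach (k - 1) y" using reach_children[OF y] x t empty by blast
    qed
    then have "card (S - outliers t) \<le> card (S \<inter> reach (k - 1) y)"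
      using finS by (intro card_mono) auto
    moreover have "card (S - outliers t) = 2"
      using out[OF tV] finS by (simp add: card_Diff_subset finite_subset)
    ultimately show False using card_ins_reach_le_1[OF k0, of v y] unfolding S_def by linarith
  qed
  have "card (\<Union>j\<in>{..k}. {w. (w, z) \<in> E ^^ j}) \<le> 2 ^ (k + 1)"
  proof (rule card_coreach_le[OF z(1) k _ z(2)])
    fix w j assume wj: "(w, z) \<in> E ^^ j" "0 < j" "j < k"
    have "w \<noteq> z" using length_unique[of z z j 0] wj z by auto
    then show "card (ins w) \<le> 2"
      using others relpow_in_V'[OF wj(1) z(1)] far_v far_z' wj by blast
  next
    have "ins z \<inter> S = {x \<in> ins z. card (ins x) = 1}" using S ins_subset by blast
    then show "2 \<le> card {x \<in> ins z. card (ins x) = 1}" using two[OF z(2)] by simp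
  qed
  moreover have "V \<subseteq> (\<Union>j\<in>{..k}. {w. (w, z) \<in> E ^^ j})"
  proof
    fix u assume u: "u \<in> V"
    \<comment> \<open>All elements of \<open>S\<close> have in-degree 1, whereas \<open>z\<close>
      has in-degree 3; so \<open>z\<close> is nobody's outlier.\<close>
    have "z \<notin> S" using S z by auto
    then have "z \<in> reach k u" using out(1)[OF u] z unfolding outliers_def by blast
    then show "u \<in> (\<Union>j\<in>{..k}. {w. (w, z) \<in> E ^^ j})" unfolding reach_def by blast
  qed
  then have "card V \<le> card (\<Union>j\<in>{..k}. {w. (w, z) \<in> E ^^ j})"
  proof (rule card_mono[rotated])
    show "finite (\<Union>j\<in>{..k}. {w. (w, z) \<in> E ^^ j})"
      by (rule finite_subset[OF _ finite_V]) (use relpow_in_V' z in blast)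
  qed
  ultimately show False using order by linarith
qed

end

section \<open>From arc lists to the adjacency relation\<close>

text \<open>Makes \<open>k_geodetic\<close> applicable to relational powers. The power 0 relates
  every element of the type to itself, but an empty walk has to sit at a vertex; hence the
  assumption on \<open>w\<close>.\<close>

lemma (in wf_digraph) relpow_arcs_ends_awalk:
  assumes "(u, w) \<in> arcs_ends G ^^ i" "w \<in> verts G"
  shows "\<exists>p. awalk u p w \<and> length p = i"
  using assms(1)
proof (induction i arbitrary: u)
  case 0
  then show ?case using assms(2) by (auto simp: awalk_Nil_iff)
next
  case (Suc i)
  then obtain x where x: "(u, x) \<in> arcs_ends G" "(x, w) \<in> arcs_ends G ^^ i"
    by (meson relpow_Suc_E2)
  obtain e where e: "e \<in> arcs G" "u = tail G e" "x = head G e"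
    using x(1) by (auto simp: arcs_ends_conv)
  obtain p where "awalk x p w" "length p = i" using Suc.IH[OF x(2)] by blast
  with e show ?case by (intro exI[of _ "e # p"]) (simp add: awalk_Cons_iff)
qed

text \<open>Each axiom follows by lifting to arc lists, attaching the extra arc at the relevant end
  and comparing the two lists. Without parallel arcs, neighbours and arcs are equally many.\<close>

lemma k_geodetic_relation:
  assumes "fin_digraph G" and geo: "k_geodetic G k" and "0 < k"
    and out: "\<And>u. u \<in> verts G \<Longrightarrow> out_degree G u = 2"
  shows "geodetic_relation (verts G) (arcs_ends G) k"
    and "w \<in> verts G \<Longrightarrow> card {x. (x, w) \<in> arcs_ends G} = in_degree G w"
proof -
  interpret fin_digraph G by fact
  have uniq: "p = q" if "awalk u p w" "length p \<le> k" "awalk u q w" "length q \<le> k" for u w p q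
    using geo that unfolding k_geodetic_def by (meson awalk_hd_in_verts awalk_last_in_verts)
  have simple: "e = f" if "e \<in> arcs G" "f \<in> arcs G" "tail G e = tail G f" "head G e = head G f" for e f
    using uniq[of "tail G e" "[e]" "head G e" "[f]"] that \<open>0 < k\<close> by (simp add: awalk_Cons_iff awalk_Nil_iff)
  have arcE: "\<exists>e. e \<in> arcs G \<and> tail G e = x \<and> head G e = y" if "(x, y) \<in> arcs_ends G" for x y
    using that by (auto simp: arcs_ends_conv)
  have verts: "x \<in> verts G" "y \<in> verts G" if "(x, y) \<in> arcs_ends G" for x y
    using that by (auto simp: arcs_ends_conv)
  have pow_verts: "w \<in> verts G" if "(u, w) \<in> arcs_ends G ^^ i" "u \<in> verts G" for u w i
    using that verts by (cases i) auto
  show "geodetic_relation (verts G) (arcs_ends G) k"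
  proof
    show "finite (verts G)" by simp
    show "arcs_ends G \<subseteq> verts G \<times> verts G" using verts by auto
  next
    fix u w i j
    assume a: "(u, w) \<in> arcs_ends G ^^ i" "(u, w) \<in> arcs_ends G ^^ j" "u \<in> verts G" "i \<le> k" "j \<le> k"
    then obtain p q where "awalk u p w" "length p = i" "awalk u q w" "length q = j"
      using relpow_arcs_ends_awalk pow_verts by metis
    then show "i = j" using uniq a by blast
  next
    fix u x w y i j
    assume a: "(u, x) \<in> arcs_ends G ^^ i" "(x, w) \<in> arcs_ends G"
      "(u, y) \<in> arcs_ends G ^^ j" "(y, w) \<in> arcs_ends G" "i < k" "j < k"
    obtain p q where pq: "awalk u p x" "length p = i" "awalk u q y" "length q = j"
      using relpow_arcs_ends_awalk a verts by metis
    obtain e f where ef: "e \<in> arcs G" "tail G e = x" "head G e = w" "f \<in> arcs G" "tail G f = y" "head G f = w"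
      using arcE a by metis
    have walks: "awalk u (p @ [e]) w" "awalk u (q @ [f]) w"
      using pq ef arc_implies_awalk awalk_appendI by metis+
    have "p @ [e] = q @ [f]" by (rule uniq[OF walks(1) _ walks(2)]) (use pq a in auto)
    then show "x = y" using ef by simp
  next
    fix u x w y i j
    assume a: "(u, x) \<in> arcs_ends G" "(x, w) \<in> arcs_ends G ^^ i"
      "(u, y) \<in> arcs_ends G" "(y, w) \<in> arcs_ends G ^^ j" "i < k" "j < k"
    have "w \<in> verts G" using a pow_verts verts by blast
    then obtain p q where pq: "awalk x p w" "length p = i" "awalk y q w" "length q = j"
      using relpow_arcs_ends_awalk a by metis
    obtain e f where ef: "e \<in> arcs G" "tail G e = u" "head G e = x" "f \<in> arcs G" "tail G f = u" "head G f = y"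
      using arcE a by metis
    have walks: "awalk u (e # p) w" "awalk u (f # q) w" using pq ef by (auto simp: awalk_Cons_iff)
    have "e # p = f # q" by (rule uniq[OF walks(1) _ walks(2)]) (use pq a in auto)
    then show "x = y" using ef by simp
  next
    fix u assume u: "u \<in> verts G"
    have "arcs_ends G `` {u} = head G ` out_arcs G u" by (auto simp: arcs_ends_conv)
    moreover have "inj_on (head G) (out_arcs G u)" using simple by (auto intro!: inj_onI)
    ultimately show "card (arcs_ends G `` {u}) = 2"
      using out[OF u] card_image unfolding out_degree_def by metis
  qed
  have "{x. (x, w) \<in> arcs_ends G} = tail G ` in_arcs G w" by (auto simp: arcs_ends_conv)
  moreover have "inj_on (tail G) (in_arcs G w)" using simple by (auto intro!: inj_onI)
  ultimately show "card {x. (x, w) \<in> arcs_ends G} = in_degree G w"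
    using card_image unfolding in_degree_def by metis
qed

section \<open>Degree counts and the theorem for digraphs\<close>

lemma (in fin_digraph) sum_degrees:
  "(\<Sum>v\<in>verts G. in_degree G v) = card (arcs G)" "(\<Sum>v\<in>verts G. out_degree G v) = card (arcs G)"
proof -
  have "arcs G = (\<Union>v\<in>verts G. in_arcs G v)" "arcs G = (\<Union>v\<in>verts G. out_arcs G v)" by auto
  moreover have "card (\<Union>v\<in>verts G. in_arcs G v) = (\<Sum>v\<in>verts G. in_degree G v)"
    unfolding in_degree_def by (rule card_UN_disjoint) auto
  moreover have "card (\<Union>v\<in>verts G. out_arcs G v) = (\<Sum>v\<in>verts G. out_degree G v)"
    unfolding out_degree_def by (rule card_UN_disjoint) auto
  ultimately show "(\<Sum>v\<in>verts G. in_degree G v) = card (arcs G)"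
    "(\<Sum>v\<in>verts G. out_degree G v) = card (arcs G)" by metis+
qed

lemma count_image_mset_set:
  "finite A \<Longrightarrow> count (image_mset f (mset_set A)) d = card {x \<in> A. f x = d}"
  by (simp add: count_image_mset vimage_def Int_def conj_commute)

theorem theorem3:
  fixes k :: nat
  assumes "k \<ge> 2"
  shows "\<not> (\<exists>G :: ('a, 'b) pre_digraph.
            fin_digraph G \<and>
            k_geodetic G k \<and>
            min_out_degree G \<ge> 2 \<and>
            card (verts G) = moore_bound 2 k + 2 \<and>
            in_degree_sequence G =
              replicate 4 1 @ replicate (card (verts G) - 7) 2 @ [3, 3, 4])"
proof
  assume "\<exists>G :: ('a, 'b) pre_digraph.
            fin_digraph G \<and>
            k_geodetic G k \<and>
            min_out_degree G \<ge> 2 \<and>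
            card (verts G) = moore_bound 2 k + 2 \<and>
            in_degree_sequence G =
              replicate 4 1 @ replicate (card (verts G) - 7) 2 @ [3, 3, 4]"
  then obtain G :: "('a, 'b) pre_digraph" where G: "fin_digraph G" "k_geodetic G k"
      "min_out_degree G \<ge> 2" "card (verts G) = moore_bound 2 k + 2"
      "in_degree_sequence G = replicate 4 1 @ replicate (card (verts G) - 7) 2 @ [3, 3, 4]"
    by blast
  interpret fin_digraph G by (rule G)
  have "(\<Sum>i=0..k. (2::nat) ^ i) = 2 ^ (k + 1) - 1"
    using mask_eq_sum_exp_nat[of "Suc k"] by (simp add: atLeast0AtMost lessThan_Suc_atMost[symmetric] lessThan_def)
  then have order: "card (verts G) = 2 ^ (k + 1) + 1"
    using G(4) unfolding moore_bound_def by simp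
  \<comment> \<open>At least 9 vertices ensure that the natural-number subtraction of 7 is not
    truncated.\<close>
  have "(2::nat) ^ 3 \<le> 2 ^ (k + 1)" using assms by (intro power_increasing) auto
  then have n: "card (verts G) \<ge> 9" using order by simp
  have degrees: "image_mset (in_degree G) (mset_set (verts G))
      = mset (replicate 4 1 @ replicate (card (verts G) - 7) 2 @ [3, 3, 4])"
    using G(5) unfolding in_degree_sequence_def by (metis mset_sorted_list_of_multiset)
  have count: "card {x \<in> verts G. in_degree G x = d}
      = count (mset (replicate 4 1 @ replicate (card (verts G) - 7) 2 @ [3, 3, 4])) d" for d
    using count_image_mset_set[of "verts G" "in_degree G" d] degrees by simp
  have "(\<Sum>v\<in>verts G. in_degree G v)
      = sum_mset (mset (replicate 4 1 @ replicate (card (verts G) - 7) 2 @ [3, 3, 4]))"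
    using degrees by (metis sum_unfold_sum_mset)
  \<comment> \<open>The in-degrees average exactly 2, since the four deficits of 1 balance the
    excesses 1 + 1 + 2.\<close>
  also have "\<dots> = (\<Sum>v\<in>verts G. 2)"
    using n by (simp add: sum_mset_sum_list sum_list_replicate)
  finally have sum: "(\<Sum>v\<in>verts G. out_degree G v) = (\<Sum>v\<in>verts G. 2)"
    using sum_degrees by simp
  have ge: "2 \<le> out_degree G u" if "u \<in> verts G" for u
  proof -
    have "min_out_degree G \<le> out_degree G u"
      unfolding min_out_degree_def using that by (intro Min_le) auto
    then show ?thesis using G(3) by linarith
  qed
  \<comment> \<open>Out-degrees of at least 2 whose sum is twice the order leave no slack at any
    vertex.\<close>
  have out: "out_degree G u = 2" if "u \<in> verts G" for u
    using sum_mono_inv[OF sum[symmetric], of u] ge that by auto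
  have "0 < k" using assms by simp
    interpret geodetic_relation "verts G" "arcs_ends G" k
    using k_geodetic_relation(1)[OF G(1,2) \<open>0 < k\<close>] out by blast
  have ins: "card (ins x) = in_degree G x" if "x \<in> verts G" for x
    unfolding ins_def using k_geodetic_relation(2)[OF G(1,2) \<open>0 < k\<close> _ that] out by blast
  have "card {x \<in> verts G. in_degree G x = 1} = 4" unfolding count by simp
  moreover have "{x \<in> verts G. card (ins x) = 1} = {x \<in> verts G. in_degree G x = 1}"
    using ins by auto
  ultimately have ones: "card {x \<in> verts G. card (ins x) = 1} = 4" by simp
  have "card {x \<in> verts G. in_degree G x = 4} = 1" unfolding count by simp
  then obtain v where v: "{x \<in> verts G. in_degree G x = 4} = {v}"
    by (meson card_1_singletonE)
  have "card {x \<in> verts G. in_degree G x = 3} = 2" unfolding count by simp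
  then obtain z z' where z: "{x \<in> verts G. in_degree G x = 3} = {z, z'}" "z \<noteq> z'"
    by (auto simp: card_2_iff)
  have "card (ins x) \<le> 2" if x: "x \<in> verts G" "x \<notin> {v, z, z'}" for x
  proof -
    have "in_degree G x \<in># image_mset (in_degree G) (mset_set (verts G))" using x by auto
    then have "in_degree G x \<in> {1, 2, 3, 4}" unfolding degrees by (auto split: if_splits)
    moreover have "in_degree G x \<noteq> 4" "in_degree G x \<noteq> 3" using x v z by blast+
    ultimately show ?thesis using ins x by auto
  qed
  moreover have "v \<in> verts G" "in_degree G v = 4" "z \<in> verts G" "in_degree G z = 3"
      "z' \<in> verts G" "in_degree G z' = 3"
    using v z by blast+
  ultimately show False
    using no_in_degrees_1111334[OF assms order ones, of v z z'] ins z(2) by auto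
qed

end
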